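(* For all integers $r\ge 2$ and $k\ge 3$, the spider $S=\operatorname{Sp}(r^k)$ satisfies $$\alpha_h(S)-\alpha_{\mathrm{bn}}(S)=k(r-1),\qquad \alpha_h(S)-\alpha_{\mathrm{bnr}}(S)=kr-1,\qquad \alpha_{\mathrm{bn}}(S)-\alpha_{\mathrm{bnr}}(S)=k-1.$$ Therefore each of the differences $\alpha_h-\alpha_{\mathrm{bn}}$, $\alpha_h-\alpha_{\mathrm{bnr}}$ and $\alpha_{\mathrm{bn}}-\alpha_{\mathrm{bnr}}$ can be arbitrarily large.
   Context: Graphs are finite and simple; $d$ is graph distance and $e(v)$ is the eccentricity of $v$. A broadcast on a nontrivial connected graph $G=(V,E)$ is a function $f:V\to\{0,1,\dots,\operatorname{diam}(G)\}$ with $f(v)\le e(v)$ for all $v\in V$. Its weight is $\sigma(f)=\sum_{v\in V}f(v)$. Let $V_f^+=\{v\in V: f(v)>0\}$ (the broadcasting vertices). A vertex $u$ hears $f$ from $v\in V_f^+$ if $d(u,v)\le f(v)$ (so a broadcasting vertex hears itself). Put $N_f(v)=\{u\in V:d(u,v)\le f(v)\}$. For $v\in V_f^+$, the private boundary $\operatorname{PB}_f(v)$ is the set of all $u\in N_f(v)$ that do not hear the broadcast obtained from $f$ by replacing the value $f(v)$ by $f(v)-1$ (all other values unchanged) from any of its broadcasting vertices. A broadcast $f$ is h-independent (hearing independent) if no vertex $u\in V_f^+$ hears $f$ from any other vertex $v\in V_f^+$. It is bn-independent (boundary independent) if whenever a vertex $x$ hears $f$ from more than one vertex of $V_f^+$,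 then $d(x,u)\ge f(u)$ for all $u\in V_f^+$ (equivalently, $d(x,u)=f(u)$ for every $u\in V_f^+$ from which $x$ hears $f$). It is bnr-independent if it is bn-independent and irredundant, i.e. $\operatorname{PB}_f(v)\ne\varnothing$ for every $v\in V_f^+$. The numbers $\alpha_h(G)$, $\alpha_{\mathrm{bn}}(G)$, $\alpha_{\mathrm{bnr}}(G)$ are the maximum weights of an h-, bn-, bnr-independent broadcast on $G$, respectively. $\operatorname{Sp}(r^k)$ is the tree obtained from a vertex $b$ of degree $k$ by attaching $k$ legs, i.e. $k$ paths starting at $b$, pairwise disjoint except for $b$, each of length (number of edges) $r$. *)

theory Defs
  imports "Graph_Theory.Graph_Theory"
begin

(* A finite simple graph is a pair_graph: a finite, loop-free, symmetric set of ordered pairs. *)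

definition nontrivial_connected_graph :: "'a pair_pre_digraph \<Rightarrow> bool" where
  "nontrivial_connected_graph G \<longleftrightarrow>
     pair_graph G \<and> Digraph_Component.connected (with_proj G) \<and> card (pverts G) \<ge> 2"

(* As a LEAST, the distance is only meaningful for vertices joined by a walk. *)
definition gdist :: "'a pair_pre_digraph \<Rightarrow> 'a \<Rightarrow> 'a \<Rightarrow> nat" where
  "gdist G u v = (LEAST n. \<exists>p. pre_digraph.awalk (with_proj G) u p v \<and> length p = n)"

definition ecc :: "'a pair_pre_digraph \<Rightarrow> 'a \<Rightarrow> nat" where
  "ecc G v = Max ((\<lambda>u. gdist G v u) ` pverts G)"

definition diam :: "'a pair_pre_digraph \<Rightarrow> nat" where
  "diam G = Max (ecc G ` pverts G)"

(* Values of f outside the vertex set are unconstrained; no notion below depends on them. *)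
definition broadcast :: "'a pair_pre_digraph \<Rightarrow> ('a \<Rightarrow> nat) \<Rightarrow> bool" where
  "broadcast G f \<longleftrightarrow> f \<in> pverts G \<rightarrow> {0..diam G} \<and> (\<forall>v \<in> pverts G. f v \<le> ecc G v)"

definition weight :: "'a pair_pre_digraph \<Rightarrow> ('a \<Rightarrow> nat) \<Rightarrow> nat" where
  "weight G f = (\<Sum>v \<in> pverts G. f v)"

definition broadcasting :: "'a pair_pre_digraph \<Rightarrow> ('a \<Rightarrow> nat) \<Rightarrow> 'a set" where
  "broadcasting G f = {v \<in> pverts G. f v > 0}"

definition hears :: "'a pair_pre_digraph \<Rightarrow> ('a \<Rightarrow> nat) \<Rightarrow> 'a \<Rightarrow> 'a \<Rightarrow> bool" where
  "hears G f u v \<longleftrightarrow> u \<in> pverts G \<and> v \<in> broadcasting G f \<and> gdist G u v \<le> f v"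

definition nbhd :: "'a pair_pre_digraph \<Rightarrow> ('a \<Rightarrow> nat) \<Rightarrow> 'a \<Rightarrow> 'a set" where
  "nbhd G f v = {u \<in> pverts G. gdist G u v \<le> f v}"

definition private_boundary :: "'a pair_pre_digraph \<Rightarrow> ('a \<Rightarrow> nat) \<Rightarrow> 'a \<Rightarrow> 'a set" where
  "private_boundary G f v = {u \<in> nbhd G f v. \<not> (\<exists>w. hears G (f(v := f v - 1)) u w)}"

definition h_independent :: "'a pair_pre_digraph \<Rightarrow> ('a \<Rightarrow> nat) \<Rightarrow> bool" where
  "h_independent G f \<longleftrightarrow>
     \<not> (\<exists>u \<in> broadcasting G f. \<exists>v \<in> broadcasting G f. v \<noteq> u \<and> hears G f u v)"

definition bn_independent :: "'a pair_pre_digraph \<Rightarrow> ('a \<Rightarrow> nat) \<Rightarrow> bool" where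
  "bn_independent G f \<longleftrightarrow>
     (\<forall>x \<in> pverts G. (\<exists>v w. v \<noteq> w \<and> hears G f x v \<and> hears G f x w) \<longrightarrow>
        (\<forall>u \<in> broadcasting G f. gdist G x u \<ge> f u))"

definition irredundant :: "'a pair_pre_digraph \<Rightarrow> ('a \<Rightarrow> nat) \<Rightarrow> bool" where
  "irredundant G f \<longleftrightarrow> (\<forall>v \<in> broadcasting G f. private_boundary G f v \<noteq> {})"

definition bnr_independent :: "'a pair_pre_digraph \<Rightarrow> ('a \<Rightarrow> nat) \<Rightarrow> bool" where
  "bnr_independent G f \<longleftrightarrow> bn_independent G f \<and> irredundant G f"

definition alpha_h :: "'a pair_pre_digraph \<Rightarrow> nat" where
  "alpha_h G = Max {weight G f | f. broadcast G f \<and> h_independent G f}"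

definition alpha_bn :: "'a pair_pre_digraph \<Rightarrow> nat" where
  "alpha_bn G = Max {weight G f | f. broadcast G f \<and> bn_independent G f}"

definition alpha_bnr :: "'a pair_pre_digraph \<Rightarrow> nat" where
  "alpha_bnr G = Max {weight G f | f. broadcast G f \<and> bnr_independent G f}"

(* The spider Sp(r^k): the centre b is (0, 0), and (i, j) with 1 <= i <= k, 1 <= j <= r
   is the vertex at distance j from b on the i-th leg. *)
definition spider_edges :: "nat \<Rightarrow> nat \<Rightarrow> ((nat \<times> nat) \<times> (nat \<times> nat)) set" where
  "spider_edges r k =
     {((0, 0), (i, 1)) | i. i \<in> {1..k} \<and> 1 \<le> r} \<union>
     {((i, j), (i, j + 1)) | i j. i \<in> {1..k} \<and> 1 \<le> j \<and> j < r}"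

definition spider :: "nat \<Rightarrow> nat \<Rightarrow> (nat \<times> nat) pair_pre_digraph" where
  "spider r k =
     \<lparr> pverts = insert (0, 0) ({1..k} \<times> {1..r}),
       parcs = spider_edges r k \<union> (spider_edges r k)\<inverse> \<rparr>"

lemma pair_graph_spider: "pair_graph (spider r k)"
proof
  fix e assume e: "e \<in> parcs (spider r k)"
  then show "fst e \<in> pverts (spider r k)" "snd e \<in> pverts (spider r k)" "fst e \<noteq> snd e"
    by (auto simp: spider_def spider_edges_def)
next
  show "finite (pverts (spider r k))" by (simp add: spider_def)
  have "parcs (spider r k) \<subseteq> pverts (spider r k) \<times> pverts (spider r k)"
    by (auto simp: spider_def spider_edges_def)
  then show "finite (parcs (spider r k))"
    by (rule finite_subset) (simp add: spider_def)
  have "arcs_ends (with_proj (spider r k)) = parcs (spider r k)"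
    by (simp add: arcs_ends_def arc_to_ends_def)
  moreover have "sym (parcs (spider r k))"
    by (simp add: spider_def sym_Un_converse)
  ultimately show "symmetric (with_proj (spider r k))"
    by (simp add: symmetric_def)
qed

lemma nontrivial_connected_spider:
  assumes "r \<ge> 1" "k \<ge> 1"
  shows "nontrivial_connected_graph (spider r k)"
proof -
  have gr: "graph (with_proj (spider r k))"
    by (rule pair_graph.pair_graphD_graph[OF pair_graph_spider])
  then have wf: "wf_digraph (with_proj (spider r k))"
    by (simp add: graph_def digraph_def fin_digraph_def)
  have sy: "symmetric (with_proj (spider r k))"
    using gr by (simp add: graph_def pseudo_graph_def sym_digraph_def sym_digraph_axioms_def)
  have leg: "(0, 0) \<rightarrow>\<^sup>*\<^bsub>with_proj (spider r k)\<^esub> (i, j)"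
    if "i \<in> {1..k}" "1 \<le> j" "j \<le> r" for i j
    using that(2,3)
  proof (induction j rule: dec_induct)
    case base
    have "((0, 0), (i, 1)) \<in> parcs (spider r k)"
      using that(1) assms by (auto simp: spider_def spider_edges_def)
    then have "(0, 0) \<rightarrow>\<^bsub>with_proj (spider r k)\<^esub> (i, 1)"
      by (simp add: arcs_ends_def arc_to_ends_def)
    then show ?case by (rule wf_digraph.reachable_adjI[OF wf])
  next
    case (step j)
    have "((i, j), (i, Suc j)) \<in> parcs (spider r k)"
      using that(1) step by (auto simp: spider_def spider_edges_def)
    then have "(i, j) \<rightarrow>\<^bsub>with_proj (spider r k)\<^esub> (i, Suc j)"
      by (simp add: arcs_ends_def arc_to_ends_def)
    moreover have "(0, 0) \<rightarrow>\<^sup>*\<^bsub>with_proj (spider r k)\<^esub> (i, j)"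
      using step by simp
    ultimately show ?case using wf_digraph.reachable_adj_trans[OF wf] by blast
  qed
  have b: "(0, 0) \<rightarrow>\<^sup>*\<^bsub>with_proj (spider r k)\<^esub> v" if v: "v \<in> pverts (spider r k)" for v
  proof (cases "v = (0, 0)")
    case True
    then show ?thesis using v wf_digraph.reachable_refl[OF wf] by simp
  next
    case False
    then obtain i j where "v = (i, j)" "i \<in> {1..k}" "1 \<le> j" "j \<le> r"
      using v by (auto simp: spider_def)
    then show ?thesis using leg by simp
  qed
  have "Digraph_Component.connected (with_proj (spider r k))"
  proof (rule wf_digraph.connectedI[OF wf])
    show "verts (with_proj (spider r k)) \<noteq> {}" by (simp add: spider_def)
    fix u v
    assume "u \<in> verts (with_proj (spider r k))" "v \<in> verts (with_proj (spider r k))"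
    then have u: "u \<in> pverts (spider r k)" and v: "v \<in> pverts (spider r k)" by simp_all
    show "u \<rightarrow>\<^sup>*\<^bsub>with_proj (mk_symmetric (with_proj (spider r k)))\<^esub> v"
      by (rule wf_digraph.reachable_mk_symmetricI[OF wf
            wf_digraph.reachable_trans[OF wf symmetric_reachable[OF sy b[OF u]] b[OF v]]])
  qed
  moreover have "card (pverts (spider r k)) \<ge> 2"
  proof -
    have "{(0, 0), (1, 1)} \<subseteq> pverts (spider r k)" using assms by (auto simp: spider_def)
    from card_mono[OF _ this] show ?thesis by (simp add: spider_def)
  qed
  ultimately show ?thesis
    using pair_graph_spider by (simp add: nontrivial_connected_graph_def)
qed

end

theory Submission
  imports Defs
begin

text \<open>The three numbers are \<open>k (2 r - 1)\<close>, \<open>k r\<close> and \<open>k (r - 1) + 1\<close>, attained by broadcasts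
  from the leaves with values \<open>2 r - 1\<close>; \<open>r\<close>; \<open>r\<close> once and \<open>r - 1\<close> otherwise.

  If \<open>f\<close> is h-independent with at least two broadcasting vertices, the intervals
  \<open>{p - f p<..p}\<close> of the positions \<open>p\<close> broadcasting on one leg are disjoint and have lower
  end at least \<open>1 - r\<close>, so a leg has weight at most \<open>2 r - 1\<close>.

  If \<open>f\<close> is bn-independent, no edge lies inside two broadcast neighbourhoods, as its two ends
  have different distances to each vertex. A vertex \<open>v\<close> covers at least \<open>f v\<close> of the \<open>k r\<close>
  edges, whence \<open>k r\<close>. If moreover \<open>f\<close> is irredundant and some broadcast passes beyond the
  centre, it covers \<open>k - 1\<close> edges in excess of its value (one fewer for a leaf of value
  \<open>r + 1\<close>, but then an edge at its private boundary is uncovered). Otherwise every broadcast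
  stays on its leg, a leg has weight \<open>r\<close> only if its leaf has value \<open>r\<close>, and irredundance
  allows this on one leg only, since the private boundary of that leaf is the centre.\<close>

subsection \<open>Distances in a spider\<close>

text \<open>The two truncated differences add up to the absolute difference. The centre has first
  coordinate 0, which no leg uses, so the second branch also gives its distance to every leg
  vertex.\<close>

definition spider_dist :: "nat \<times> nat \<Rightarrow> nat \<times> nat \<Rightarrow> nat" where
  "spider_dist u v =
     (if fst u = fst v then (snd u - snd v) + (snd v - snd u) else snd u + snd v)"

lemma pverts_spider: "pverts (spider r k) = insert (0, 0) ({1..k} \<times> {1..r})"
  by (simp add: spider_def)

lemma finite_pverts_spider [simp]: "finite (pverts (spider r k))"
  by (simp add: pverts_spider)

lemma wf_digraph_spider: "wf_digraph (with_proj (spider r k))"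
  using pair_graph.pair_graphD_graph[OF pair_graph_spider]
  by (simp add: graph_def digraph_def fin_digraph_def)

lemma spider_dist_step:
  assumes "(u, w) \<in> parcs (spider r k)"
  shows "spider_dist u v \<le> Suc (spider_dist w v)"
  using assms by (auto simp: spider_def spider_edges_def spider_dist_def)

lemma spider_dist_le_length:
  assumes "pre_digraph.awalk (with_proj (spider r k)) u p v"
  shows "spider_dist u v \<le> length p"
  using assms
proof (induction p arbitrary: u)
  case Nil
  then show ?case
    by (simp add: wf_digraph.awalk_Nil_iff[OF wf_digraph_spider] spider_dist_def)
next
  case (Cons e p)
  then have "e \<in> parcs (spider r k)" "u = fst e"
    "pre_digraph.awalk (with_proj (spider r k)) (snd e) p v"
    by (simp_all add: wf_digraph.awalk_Cons_iff[OF wf_digraph_spider])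
  then show ?case
    using Cons.IH[of "snd e"] spider_dist_step[of "fst e" "snd e" r k v] by simp
qed

lemma spider_dist_descent:
  assumes "u \<in> pverts (spider r k)" "v \<in> pverts (spider r k)" "spider_dist u v = Suc n"
  shows "\<exists>w \<in> pverts (spider r k). (u, w) \<in> parcs (spider r k) \<and> spider_dist w v = n"
proof -
  obtain i j i' j' where uv: "u = (i, j)" "v = (i', j')" by (cases u, cases v)
  \<comment> \<open>One step of the path to \<open>v\<close>: from the centre onto the leg of
    \<open>v\<close>, outwards if \<open>v\<close> lies further out on the same leg, inwards
    otherwise. Position 1 is treated apart because the centre is \<open>(0, 0)\<close> and not
    \<open>(i, 0)\<close>.\<close>
  define w where "w = (if j = 0 then (i', 1) else if i = i' \<and> j < j' then (i, j + 1)
    else if j = 1 then (0, 0) else (i, j - 1))"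
  have "w \<in> pverts (spider r k)" "(u, w) \<in> parcs (spider r k)" "spider_dist w v = n"
    using assms unfolding uv w_def
    by (auto simp: spider_def spider_edges_def spider_dist_def split: if_splits)
  then show ?thesis by blast
qed

lemma ex_awalk_spider_dist:
  assumes "u \<in> pverts (spider r k)" "v \<in> pverts (spider r k)"
  shows "\<exists>p. pre_digraph.awalk (with_proj (spider r k)) u p v \<and> length p = spider_dist u v"
  using assms
proof (induction "spider_dist u v" arbitrary: u)
  case 0
  then have "u = v" by (auto simp: spider_dist_def pverts_spider split: if_splits)
  then show ?case
    using 0 by (intro exI[of _ "[]"]) (simp add: wf_digraph.awalk_Nil_iff[OF wf_digraph_spider])
next
  case (Suc n)
  obtain w where w: "w \<in> pverts (spider r k)" "(u, w) \<in> parcs (spider r k)" "spider_dist w v = n"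
    using spider_dist_descent[of u r k v n] Suc by auto
  then obtain p where "pre_digraph.awalk (with_proj (spider r k)) w p v" "length p = n"
    using Suc.hyps(1)[of w] Suc.prems by blast
  then show ?case
    using w Suc(2)
    by (intro exI[of _ "(u, w) # p"]) (simp add: wf_digraph.awalk_Cons_iff[OF wf_digraph_spider])
qed

lemma gdist_spider:
  assumes "u \<in> pverts (spider r k)" "v \<in> pverts (spider r k)"
  shows "gdist (spider r k) u v = spider_dist u v"
  unfolding gdist_def
  using ex_awalk_spider_dist[OF assms] by (intro Least_equality) (auto dest: spider_dist_le_length)

lemma ecc_spider:
  assumes "k \<ge> 2" "r \<ge> 1" "v \<in> pverts (spider r k)"
  shows "ecc (spider r k) v = snd v + r"
  unfolding ecc_def
proof (rule Max_eqI)
  show "finite (gdist (spider r k) v ` pverts (spider r k))" by simp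
  show "y \<le> snd v + r" if "y \<in> gdist (spider r k) v ` pverts (spider r k)" for y
    using that assms(3) by (auto simp: gdist_spider) (auto simp: spider_dist_def pverts_spider)
  \<comment> \<open>A leaf on a leg that does not contain \<open>v\<close>; this choice needs two
    legs.\<close>
  define w where "w = (if fst v = 1 then 2 else 1 :: nat, r)"
  have "w \<in> pverts (spider r k)" using assms by (auto simp: w_def pverts_spider)
  moreover have "spider_dist v w = snd v + r" by (auto simp: w_def spider_dist_def)
  ultimately show "snd v + r \<in> gdist (spider r k) v ` pverts (spider r k)"
    using assms(3) by (auto simp: gdist_spider intro!: image_eqI[of _ _ w])
qed

text \<open>Only the eccentricity bound remains, since it implies the bound by the diameter.\<close>

lemma broadcast_spider_iff:
  assumes "k \<ge> 2" "r \<ge> 1"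
  shows "broadcast (spider r k) f \<longleftrightarrow> (\<forall>v \<in> pverts (spider r k). f v \<le> snd v + r)"
proof -
  have "ecc (spider r k) v \<le> diam (spider r k)" if "v \<in> pverts (spider r k)" for v
    using that unfolding diam_def by (intro Max_ge) auto
  then show ?thesis
    using ecc_spider[OF assms] by (fastforce simp: broadcast_def intro: order_trans)
qed

lemma hears_spider_iff:
  "hears (spider r k) f u v \<longleftrightarrow>
     u \<in> pverts (spider r k) \<and> v \<in> pverts (spider r k) \<and> 0 < f v \<and> spider_dist u v \<le> f v"
  by (auto simp: hears_def broadcasting_def gdist_spider)

lemma weight_spider: "weight (spider r k) f = f (0, 0) + (\<Sum>i = 1..k. \<Sum>j = 1..r. f (i, j))"
  by (simp add: weight_def pverts_spider sum.cartesian_product)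

lemma weight_eq_sum_broadcasting:
  assumes "finite (pverts G)"
  shows "weight G f = sum f (broadcasting G f)"
  unfolding weight_def broadcasting_def
  using assms by (intro sum.mono_neutral_right) auto

text \<open>The upper bound also supplies the finiteness that \<open>Max\<close> requires, even when
  infinitely many functions satisfy \<open>P\<close>.\<close>

lemma Max_weight_eqI:
  assumes "\<And>f. P f \<Longrightarrow> weight G f \<le> B" "P g" "weight G g = B"
  shows "Max {weight G f | f. P f} = B"
proof (rule Max_eqI)
  show "finite {weight G f | f. P f}"
    by (rule finite_subset[of _ "{..B}"]) (auto simp: assms(1))
qed (use assms in auto)

subsection \<open>Hearing independence\<close>

text \<open>The last hypothesis makes the intervals \<open>{p - g p<..p}\<close> pairwise disjoint.\<close>
lemma sum_le_card_of_intervals: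
  fixes g :: "nat \<Rightarrow> nat" and U :: "int set"
  assumes "finite U"
    and sub: "\<And>p. p \<in> {1..r} \<Longrightarrow> 0 < g p \<Longrightarrow> {int p - int (g p)<..int p} \<subseteq> U"
    and gap: "\<And>p q. p \<in> {1..r} \<Longrightarrow> q \<in> {1..r} \<Longrightarrow> q < p \<Longrightarrow> 0 < g p \<Longrightarrow> 0 < g q \<Longrightarrow> g p < p - q"
  shows "(\<Sum>p = 1..r. g p) \<le> card U"
proof -
  let ?P = "{p \<in> {1..r}. 0 < g p}" and ?I = "\<lambda>p. {int p - int (g p)<..int p}"
  have disj: "?I p \<inter> ?I q = {}" if "p \<in> ?P" "q \<in> ?P" "q < p" for p q
    using gap[of p q] that by auto
  have "?I p \<inter> ?I q = {}" if "p \<in> ?P" "q \<in> ?P" "p \<noteq> q" for p q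
    using disj[of p q] disj[of q p] that by (cases p q rule: linorder_cases) blast+
  then have "card (\<Union>p \<in> ?P. ?I p) = (\<Sum>p \<in> ?P. card (?I p))"
    by (intro card_UN_disjoint) auto
  also have "\<dots> = (\<Sum>p \<in> ?P. g p)" by simp
  also have "\<dots> = (\<Sum>p = 1..r. g p)" by (intro sum.mono_neutral_left) auto
  finally show ?thesis
    using card_mono[OF \<open>finite U\<close>, of "\<Union>p \<in> ?P. ?I p"] sub by fastforce
qed

lemma h_independent_spiderD:
  assumes "h_independent (spider r k) f"
    "u \<in> pverts (spider r k)" "v \<in> pverts (spider r k)" "u \<noteq> v" "0 < f u" "0 < f v"
  shows "f v < spider_dist u v"
proof (rule ccontr)
  assume "\<not> ?thesis"
  then have "hears (spider r k) f u v" using assms by (simp add: hears_spider_iff)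
  moreover have "u \<in> broadcasting (spider r k) f" "v \<in> broadcasting (spider r k) f"
    using assms by (simp_all add: broadcasting_def)
  moreover note \<open>u \<noteq> v\<close>
  ultimately show False using assms(1) unfolding h_independent_def by metis
qed

text \<open>The intervals extend inwards from their positions, so it is enough that the inner of two
  broadcasting vertices does not hear the outer one. \<open>U\<close> is left open because the room
  available to the intervals differs between the applications.\<close>

lemma h_independent_leg_sum_le:
  assumes h: "h_independent (spider r k) f" and i: "i \<in> {1..k}" and "finite U"
    and sub: "\<And>p. p \<in> {1..r} \<Longrightarrow> 0 < f (i, p) \<Longrightarrow> {int p - int (f (i, p))<..int p} \<subseteq> U"
  shows "(\<Sum>p = 1..r. f (i, p)) \<le> card U"
proof (rule sum_le_card_of_intervals[OF \<open>finite U\<close> sub])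
  fix p q assume "p \<in> {1..r}" "q \<in> {1..r}" "q < p" "0 < f (i, p)" "0 < f (i, q)"
  then show "f (i, p) < p - q"
    using h_independent_spiderD[OF h, of "(i, q)" "(i, p)"] i
    by (auto simp: pverts_spider spider_dist_def)
qed

lemma weight_h_independent_le:
  assumes r: "r \<ge> 2" and k: "k \<ge> 3"
    and b: "broadcast (spider r k) f" and h: "h_independent (spider r k) f"
  shows "weight (spider r k) f \<le> k * (2 * r - 1)"
proof (cases "\<exists>v. broadcasting (spider r k) f \<subseteq> {v}")
  \<comment> \<open>A lone broadcast may have value \<open>2 * r\<close>, which breaks the bound
    \<open>2 * r - 1\<close> for its leg, so it is compared with the total directly.\<close>
  case True
  then obtain v where v: "broadcasting (spider r k) f \<subseteq> {v}" by blast
  have "f v \<le> 2 * r" if "v \<in> broadcasting (spider r k) f"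
    using b r k that by (fastforce simp: broadcast_spider_iff broadcasting_def pverts_spider)
  then have "weight (spider r k) f \<le> 2 * r"
    using v by (auto simp: weight_eq_sum_broadcasting subset_singleton_iff)
  also have "\<dots> \<le> 3 * (2 * r - 1)" using r by simp
  also have "\<dots> \<le> k * (2 * r - 1)" using k by (rule mult_right_mono) simp
  finally show ?thesis .
next
  case False
  have other: "\<exists>u \<in> pverts (spider r k). u \<noteq> v \<and> 0 < f u" for v
    using False unfolding broadcasting_def by blast
  \<comment> \<open>A second broadcasting vertex \<open>u\<close> must not hear \<open>v\<close>,
    and its distance from \<open>v\<close> is at most \<open>snd v + r\<close>.\<close>
  have lt: "f v < snd v + r" if v: "v \<in> pverts (spider r k)" "0 < f v" for v
  proof -
    obtain u where u: "u \<in> pverts (spider r k)" "u \<noteq> v" "0 < f u" using other by blast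
    from h_independent_spiderD[OF h u(1) v(1) u(2,3) v(2)] u(1) v(1)
    show ?thesis by (auto simp: spider_dist_def pverts_spider split: if_splits)
  qed
  show ?thesis
  proof (cases "f (0, 0) = 0")
    case True
    have "(\<Sum>p = 1..r. f (i, p)) \<le> 2 * r - 1" if "i \<in> {1..k}" for i
    proof -
      have "(\<Sum>p = 1..r. f (i, p)) \<le> card {1 - int r<..int r}"
      proof (rule h_independent_leg_sum_le[OF h that])
        fix p assume "p \<in> {1..r}" "0 < f (i, p)"
        then show "{int p - int (f (i, p))<..int p} \<subseteq> {1 - int r<..int r}"
          using lt[of "(i, p)"] that by (auto simp: pverts_spider)
      qed simp
      then show ?thesis by simp
    qed
    then show ?thesis
      using True sum_bounded_above[of "{1..k}" "\<lambda>i. \<Sum>p = 1..r. f (i, p)" "2 * r - 1"]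
      by (simp add: weight_spider)
  next
    case False
    \<comment> \<open>A broadcasting centre must not hear \<open>(i, p)\<close>, so
      \<open>f (i, p) < p\<close> and every interval starts at 1 or later. The loss on the legs
      outweighs the value of the centre.\<close>
    have "(\<Sum>p = 1..r. f (i, p)) \<le> r - 1" if "i \<in> {1..k}" for i
    proof -
      have "(\<Sum>p = 1..r. f (i, p)) \<le> card {1<..int r}"
      proof (rule h_independent_leg_sum_le[OF h that])
        fix p assume "p \<in> {1..r}" "0 < f (i, p)"
        then show "{int p - int (f (i, p))<..int p} \<subseteq> {1<..int r}"
          using h_independent_spiderD[OF h, of "(0, 0)" "(i, p)"] False that
          by (auto simp: pverts_spider spider_dist_def)
      qed simp
      then show ?thesis by simp
    qed
    then have "weight (spider r k) f \<le> f (0, 0) + k * (r - 1)"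
      using sum_bounded_above[of "{1..k}" "\<lambda>i. \<Sum>p = 1..r. f (i, p)" "r - 1"]
      by (simp add: weight_spider)
    also have "\<dots> \<le> k * r + k * (r - 1)"
    proof -
      have "f (0, 0) \<le> r" using lt[of "(0, 0)"] False by (simp add: pverts_spider)
      also have "r \<le> k * r" using k by simp
      finally show ?thesis by simp
    qed
    also have "\<dots> = k * (r + (r - 1))" by (simp add: distrib_left)
    also have "r + (r - 1) = 2 * r - 1" by simp
    finally show ?thesis .
  qed
qed

lemma alpha_h_spider:
  assumes r: "r \<ge> 2" and k: "k \<ge> 3"
  shows "alpha_h (spider r k) = k * (2 * r - 1)"
  unfolding alpha_h_def
proof (rule Max_weight_eqI[where g = "\<lambda>v. if snd v = r then 2 * r - 1 else 0"])
  let ?g = "\<lambda>v :: nat \<times> nat. if snd v = r then 2 * r - 1 else 0"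
  have "broadcast (spider r k) ?g" using r k by (auto simp: broadcast_spider_iff)
  \<comment> \<open>Distinct leaves are at distance \<open>2 * r\<close>, one more than the value
    used.\<close>
  moreover have "h_independent (spider r k) ?g"
    using r by (auto simp: h_independent_def broadcasting_def hears_spider_iff
        spider_dist_def pverts_spider split: if_splits)
  ultimately show "broadcast (spider r k) ?g \<and> h_independent (spider r k) ?g" by blast
  show "weight (spider r k) ?g = k * (2 * r - 1)"
    using r by (simp add: weight_spider sum.delta)
qed (use weight_h_independent_le[OF r k] in blast)

subsection \<open>Boundary independence\<close>

text \<open>The edge joining \<open>(i, j)\<close> to the next vertex towards the centre is represented by \<open>(i, j)\<close>.\<close>
definition towards_centre :: "nat \<times> nat \<Rightarrow> nat \<times> nat" where
  "towards_centre e = (if snd e = 1 then (0, 0) else (fst e, snd e - 1))"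

definition covered_edges :: "nat \<Rightarrow> nat \<Rightarrow> (nat \<times> nat \<Rightarrow> nat) \<Rightarrow> nat \<times> nat \<Rightarrow> (nat \<times> nat) set" where
  "covered_edges r k f v =
     {e \<in> {1..k} \<times> {1..r}. spider_dist e v \<le> f v \<and> spider_dist (towards_centre e) v \<le> f v}"

lemma finite_covered_edges [simp]: "finite (covered_edges r k f v)"
  by (rule finite_subset[of _ "{1..k} \<times> {1..r}"]) (auto simp: covered_edges_def)

lemma towards_centre_in_pverts:
  assumes "e \<in> {1..k} \<times> {1..r}"
  shows "towards_centre e \<in> pverts (spider r k)"
  using assms by (auto simp: towards_centre_def pverts_spider)

text \<open>A tree is bipartite: the two ends of an edge have distances of different parity to any
  vertex.\<close>

lemma spider_dist_towards_centre_neq: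
  assumes "e \<in> {1..k} \<times> {1..r}" "v \<in> pverts (spider r k)"
  shows "spider_dist (towards_centre e) v \<noteq> spider_dist e v"
  using assms by (auto simp: towards_centre_def pverts_spider spider_dist_def)

lemma bn_independent_spiderD:
  assumes "bn_independent (spider r k) f" "x \<in> pverts (spider r k)"
    "v \<in> broadcasting (spider r k) f" "w \<in> broadcasting (spider r k) f" "v \<noteq> w"
    "spider_dist x v \<le> f v" "spider_dist x w \<le> f w"
  shows "spider_dist x v = f v"
proof -
  have "hears (spider r k) f x v" "hears (spider r k) f x w"
    using assms by (simp_all add: hears_spider_iff broadcasting_def)
  then have "f v \<le> gdist (spider r k) x v"
    using assms unfolding bn_independent_def by blast
  then show ?thesis
    using assms by (simp add: gdist_spider broadcasting_def)
qed

text \<open>Both ends of a common edge would hear \<open>v\<close> and \<open>w\<close>, which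
  forces both to lie at distance exactly \<open>f v\<close> from \<open>v\<close>.\<close>

lemma covered_edges_disjoint:
  assumes bn: "bn_independent (spider r k) f"
    and v: "v \<in> broadcasting (spider r k) f" and w: "w \<in> broadcasting (spider r k) f"
    and "v \<noteq> w"
  shows "covered_edges r k f v \<inter> covered_edges r k f w = {}"
proof (rule ccontr)
  assume "\<not> ?thesis"
  then obtain e where e: "e \<in> covered_edges r k f v" "e \<in> covered_edges r k f w" by blast
  then have E: "e \<in> {1..k} \<times> {1..r}" by (simp add: covered_edges_def)
  have "spider_dist x v = f v" if "x = e \<or> x = towards_centre e" for x
    using bn_independent_spiderD[OF bn _ v w \<open>v \<noteq> w\<close>, of x] that e E
      towards_centre_in_pverts[OF E]
    by (auto simp: covered_edges_def pverts_spider)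
  then show False
    using spider_dist_towards_centre_neq[OF E, of v] v by (auto simp: broadcasting_def)
qed

lemma card_covered_edges_ge:
  assumes i: "i \<in> {1..k}" and p: "p \<in> {1..r}" and f: "f (i, p) \<le> p + r"
  shows "card (covered_edges r k f (i, p)) \<ge>
    min (f (i, p)) p + min (f (i, p)) (r - p) + (k - 1) * (f (i, p) - p)"
proof -
  let ?m = "f (i, p)"
  \<comment> \<open>\<open>A\<close> runs inwards and \<open>B\<close> outwards on the leg of
    \<open>(i, p)\<close>; \<open>C\<close> collects what is reached on the other legs, an initial
    stretch of length \<open>f (i, p) - p\<close> on each. The bound on \<open>f (i, p)\<close>
    keeps these stretches within the legs.\<close>
  define A where "A = {i} \<times> {p - ?m<..p}"
  define B where "B = {i} \<times> {p<..p + min ?m (r - p)}"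
  define C where "C = ({1..k} - {i}) \<times> {1..?m - p}"
  have "A \<union> B \<union> C \<subseteq> covered_edges r k f (i, p)"
    using i p f unfolding A_def B_def C_def covered_edges_def
    by (auto simp: towards_centre_def spider_dist_def)
  then have "card (A \<union> B \<union> C) \<le> card (covered_edges r k f (i, p))"
    by (rule card_mono[OF finite_covered_edges])
  moreover have "card (A \<union> B \<union> C) = card A + card B + card C"
  proof -
    have "A \<inter> B = {}" "(A \<union> B) \<inter> C = {}" by (auto simp: A_def B_def C_def)
    moreover have "finite A" "finite B" "finite C" by (auto simp: A_def B_def C_def)
    ultimately show ?thesis by (simp add: card_Un_disjoint)
  qed
  moreover have "card A = min ?m p" "card B = min ?m (r - p)" "card C = (k - 1) * (?m - p)"
    using i by (auto simp: A_def B_def C_def card_cartesian_product)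
  ultimately show ?thesis by simp
qed

lemma card_covered_edges_centre_ge:
  assumes "f (0, 0) \<le> r"
  shows "card (covered_edges r k f (0, 0)) \<ge> k * f (0, 0)"
proof -
  have "{1..k} \<times> {1..f (0, 0)} \<subseteq> covered_edges r k f (0, 0)"
    using assms by (auto simp: covered_edges_def towards_centre_def spider_dist_def)
  from card_mono[OF finite_covered_edges this] show ?thesis
    by (simp add: card_cartesian_product)
qed

text \<open>The edges from \<open>v\<close> to the centre and on along a single other leg already
  number \<open>f v\<close>, up to the point where the broadcast stops.\<close>

lemma le_card_covered_edges:
  assumes k: "k \<ge> 2" and r: "r \<ge> 1" and b: "broadcast (spider r k) f"
    and v: "v \<in> pverts (spider r k)"
  shows "f v \<le> card (covered_edges r k f v)"
proof (cases "v = (0, 0)")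
  case True
  have "f (0, 0) \<le> r" using b k r by (force simp: broadcast_spider_iff pverts_spider)
  from card_covered_edges_centre_ge[of f, OF this]
  have "k * f (0, 0) \<le> card (covered_edges r k f (0, 0))" .
  moreover have "1 * f (0, 0) \<le> k * f (0, 0)" using k by (intro mult_right_mono) auto
  ultimately have "f (0, 0) \<le> card (covered_edges r k f (0, 0))" by linarith
  then show ?thesis using True by simp
next
  case False
  then obtain i p where ip: "v = (i, p)" "i \<in> {1..k}" "p \<in> {1..r}"
    using v by (auto simp: pverts_spider)
  have "1 * (f v - p) \<le> (k - 1) * (f v - p)" using k by (intro mult_right_mono) auto
  moreover have "f v \<le> p + r" using b v k r ip(1) by (auto simp: broadcast_spider_iff)
  moreover from this have "min (f v) p + min (f v) (r - p) + (k - 1) * (f v - p)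
      \<le> card (covered_edges r k f v)"
    using card_covered_edges_ge[OF ip(2,3), of f] ip(1) by simp
  ultimately show ?thesis by linarith
qed

text \<open>The covered sets are disjoint and each is at least as large as its value, so a surplus
  \<open>s\<close> at one vertex survives in the total. Bounding by the union instead of
  \<open>k * r\<close> lets uncovered edges be subtracted later.\<close>

lemma weight_add_excess_le:
  assumes "k \<ge> 2" "r \<ge> 1" and b: "broadcast (spider r k) f"
    and bn: "bn_independent (spider r k) f"
    and v: "v \<in> broadcasting (spider r k) f" and s: "f v + s \<le> card (covered_edges r k f v)"
  shows "weight (spider r k) f + s \<le>
    card (\<Union>w \<in> broadcasting (spider r k) f. covered_edges r k f w)"
proof -
  let ?B = "broadcasting (spider r k) f"
  have fin: "finite ?B" by (simp add: broadcasting_def)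
  have "weight (spider r k) f + s = (f v + s) + sum f (?B - {v})"
    using v fin by (simp add: weight_eq_sum_broadcasting sum.remove[of _ v])
  also have "\<dots> \<le> card (covered_edges r k f v) + (\<Sum>w \<in> ?B - {v}. card (covered_edges r k f w))"
    using s le_card_covered_edges[OF assms(1-3)]
    by (intro add_mono sum_mono) (auto simp: broadcasting_def)
  also have "\<dots> = (\<Sum>w \<in> ?B. card (covered_edges r k f w))"
    using v fin by (simp add: sum.remove[of _ v])
  also have "\<dots> = card (\<Union>w \<in> ?B. covered_edges r k f w)"
    using fin covered_edges_disjoint[OF bn] by (intro card_UN_disjoint[symmetric]) auto
  finally show ?thesis .
qed

lemma weight_bn_independent_le:
  assumes "k \<ge> 2" "r \<ge> 1" "broadcast (spider r k) f" "bn_independent (spider r k) f"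
  shows "weight (spider r k) f \<le> k * r"
proof (cases "broadcasting (spider r k) f = {}")
  case True
  then show ?thesis by (simp add: weight_eq_sum_broadcasting)
next
  case False
  then obtain v where v: "v \<in> broadcasting (spider r k) f" by blast
  then have "weight (spider r k) f \<le>
      card (\<Union>w \<in> broadcasting (spider r k) f. covered_edges r k f w)"
    using weight_add_excess_le[OF assms v, of 0] le_card_covered_edges[OF assms(1-3), of v]
    by (simp add: broadcasting_def)
  also have "\<dots> \<le> card ({1..k} \<times> {1..r})"
    by (intro card_mono) (auto simp: covered_edges_def)
  finally show ?thesis by (simp add: card_cartesian_product)
qed

text \<open>Of two leaves heard by \<open>x\<close>, one is on another leg, at distance
  \<open>snd x + r\<close>. Hence \<open>x\<close> is the centre, and its distance \<open>r\<close>
  to each leaf is at least the value there.\<close>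

lemma bn_independent_of_leaves:
  assumes leaf: "\<And>v. v \<in> pverts (spider r k) \<Longrightarrow> 0 < f v \<Longrightarrow> snd v = r \<and> f v \<le> r"
  shows "bn_independent (spider r k) f"
  unfolding bn_independent_def
proof (intro ballI impI, elim exE conjE)
  fix x u v w
  assume x: "x \<in> pverts (spider r k)" and u: "u \<in> broadcasting (spider r k) f"
    and "v \<noteq> w" and hv: "hears (spider r k) f x v" and hw: "hears (spider r k) f x w"
  have v: "snd v = r" "f v \<le> r" "spider_dist x v \<le> f v"
    using hv leaf[of v] by (auto simp: hears_spider_iff)
  have w: "snd w = r" "f w \<le> r" "spider_dist x w \<le> f w"
    using hw leaf[of w] by (auto simp: hears_spider_iff)
  have "fst x \<noteq> fst v \<or> fst x \<noteq> fst w"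
    using \<open>v \<noteq> w\<close> v(1) w(1) by (auto simp: prod_eq_iff)
  then have "snd x + r \<le> r"
  proof
    assume "fst x \<noteq> fst v"
    then show ?thesis using v by (simp add: spider_dist_def)
  next
    assume "fst x \<noteq> fst w"
    then show ?thesis using w by (simp add: spider_dist_def)
  qed
  then show "f u \<le> gdist (spider r k) x u"
    using u x leaf[of u] by (auto simp: broadcasting_def gdist_spider spider_dist_def)
qed

lemma alpha_bn_spider:
  assumes r: "r \<ge> 2" and k: "k \<ge> 3"
  shows "alpha_bn (spider r k) = k * r"
  unfolding alpha_bn_def
proof (rule Max_weight_eqI[where g = "\<lambda>v. if snd v = r then r else 0"])
  let ?g = "\<lambda>v :: nat \<times> nat. if snd v = r then r else 0"
  have "broadcast (spider r k) ?g" using r k by (auto simp: broadcast_spider_iff)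
  moreover have "bn_independent (spider r k) ?g"
    by (rule bn_independent_of_leaves) (simp split: if_splits)
  ultimately show "broadcast (spider r k) ?g \<and> bn_independent (spider r k) ?g" by blast
  show "weight (spider r k) ?g = k * r"
    using r by (simp add: weight_spider sum.delta)
qed (use weight_bn_independent_le[of k r] r k in auto)

subsection \<open>Irredundance\<close>

text \<open>With \<open>f v\<close> at least 2, \<open>v\<close> still broadcasts after the
  decrease, so a private boundary vertex lies at distance exactly \<open>f v\<close>. For value 1 it
  could be \<open>v\<close> itself.\<close>

lemma ex_private_boundary_spider:
  assumes ir: "irredundant (spider r k) f" and v: "v \<in> pverts (spider r k)" and "2 \<le> f v"
  obtains u where "u \<in> pverts (spider r k)" "spider_dist u v = f v"
    "\<And>w. w \<in> pverts (spider r k) \<Longrightarrow> w \<noteq> v \<Longrightarrow> 0 < f w \<Longrightarrow> f w < spider_dist u w"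
proof -
  have "v \<in> broadcasting (spider r k) f" using assms by (simp add: broadcasting_def)
  then have "private_boundary (spider r k) f v \<noteq> {}"
    using ir unfolding irredundant_def by blast
  then obtain u where "u \<in> private_boundary (spider r k) f v" by blast
  then have u: "u \<in> pverts (spider r k)" "gdist (spider r k) u v \<le> f v"
    and no: "\<And>w. \<not> hears (spider r k) (f(v := f v - 1)) u w"
    unfolding private_boundary_def nbhd_def by blast+
  have "spider_dist u v = f v"
    using no[of v] u v \<open>2 \<le> f v\<close> by (simp add: hears_spider_iff gdist_spider)
  moreover have "f w < spider_dist u w" if "w \<in> pverts (spider r k)" "w \<noteq> v" "0 < f w" for w
    using no[of w] u that by (simp add: hears_spider_iff)
  ultimately show thesis using that u(1) by blast
qed

text \<open>A broadcasting vertex that hears another one also hears itself, at distance 0, which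
  would have to equal its positive value. This makes the interval bound on a leg available
  again.\<close>

lemma bn_independent_imp_h_independent:
  assumes bn: "bn_independent (spider r k) f"
  shows "h_independent (spider r k) f"
  unfolding h_independent_def
proof (intro notI, elim bexE conjE)
  fix u v
  assume u: "u \<in> broadcasting (spider r k) f" and v: "v \<in> broadcasting (spider r k) f"
    and "v \<noteq> u" "hears (spider r k) f u v"
  then have "spider_dist u u = f u"
    by (intro bn_independent_spiderD[OF bn _ u v])
      (auto simp: hears_spider_iff spider_dist_def)
  then show False using u by (simp add: spider_dist_def broadcasting_def)
qed

lemma weight_bnr_independent_le_of_crossing:
  assumes r: "r \<ge> 2" and k: "k \<ge> 3" and b: "broadcast (spider r k) f"
    and bn: "bn_independent (spider r k) f" and ir: "irredundant (spider r k) f"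
    and v: "v \<in> broadcasting (spider r k) f" and cross: "snd v < f v"
  shows "weight (spider r k) f + (k - 1) \<le> k * r"
proof -
  let ?U = "\<Union>w \<in> broadcasting (spider r k) f. covered_edges r k f w"
  let ?E = "{1..k} \<times> {1..r}"
  have k2: "k \<ge> 2" and r1: "r \<ge> 1" using r k by auto
  note excess = weight_add_excess_le[OF k2 r1 b bn v]
  have U: "?U \<subseteq> ?E" by (auto simp: covered_edges_def)
  then have cardU: "card ?U \<le> k * r"
    using card_mono[of ?E ?U] by (simp add: card_cartesian_product)
  have vV: "v \<in> pverts (spider r k)" using v by (simp add: broadcasting_def)
  have fv: "f v \<le> snd v + r" using b vV k2 r1 by (simp add: broadcast_spider_iff)
  show ?thesis
  proof (cases "v = (0, 0)")
    case True
    have "f v + (k - 1) \<le> f v + (k - 1) * f v" using cross by simp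
    also have "\<dots> = k * f v" using k by (cases k) simp_all
    also have "\<dots> \<le> card (covered_edges r k f v)"
      using card_covered_edges_centre_ge[of f r k] fv True by simp
    finally show ?thesis using excess cardU by (meson order_trans)
  next
    case False
    then obtain i p where ip: "v = (i, p)" "i \<in> {1..k}" "p \<in> {1..r}"
      using vV by (auto simp: pverts_spider)
    \<comment> \<open>\<open>t\<close> is the reach beyond the centre.\<close>
    obtain t where t: "f v = p + t" "t \<ge> 1" "t \<le> r"
      using cross fv ip(1) by (metis add.commute add_le_cancel_left less_imp_add_positive
          less_eq_Suc_le One_nat_def snd_conv)
    obtain m where m: "k = m + 3" using k by (metis add.commute le_Suc_ex)
    have card: "p + min (f v) (r - p) + (k - 1) * t \<le> card (covered_edges r k f v)"
      using card_covered_edges_ge[OF ip(2,3), of f] fv ip(1) t by simp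
    show ?thesis
    proof (cases "p < r \<or> t \<ge> 2")
      case True
      \<comment> \<open>The surplus is \<open>(k - 2) * t\<close> plus the edges outwards from
        \<open>v\<close>. For \<open>t\<close> at least 2 this suffices as \<open>k\<close> is at
        least 3; for \<open>t = 1\<close> one outward edge makes up the difference.\<close>
      have "f v + (k - 1) \<le> p + min (f v) (r - p) + (k - 1) * t"
      proof (cases "t \<ge> 2")
        case True
        then have "m * 2 \<le> m * t" by simp
        moreover have "(k - 1) * t = m * t + 2 * t" using m by (simp add: algebra_simps)
        ultimately show ?thesis using True t(1) m by linarith
      next
        case False
        then have "t = 1" using t by simp
        then show ?thesis using \<open>p < r \<or> t \<ge> 2\<close> t m by simp
      qed
      then show ?thesis using card excess cardU by (meson order_trans)
    next
      case False
      then have pr: "p = r" "t = 1" using ip(3) t by auto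
      have "f v + (k - 2) \<le> card (covered_edges r k f v)" using card pr t m by simp
      then have W: "weight (spider r k) f + (k - 2) \<le> card ?U" by (rule excess)
      obtain u where u: "u \<in> pverts (spider r k)" "spider_dist u v = f v"
        "\<And>w. w \<in> pverts (spider r k) \<Longrightarrow> w \<noteq> v \<Longrightarrow> 0 < f w \<Longrightarrow> f w < spider_dist u w"
        using ex_private_boundary_spider[OF ir vV] t pr r by auto
      \<comment> \<open>The own leg and the centre are too close to the leaf; at distance
        \<open>r + 1\<close> only first vertices of other legs remain.\<close>
      have u1: "fst u \<in> {1..k}" "fst u \<noteq> i" "snd u = 1"
        using u(1,2) t pr ip by (auto simp: pverts_spider spider_dist_def split: if_splits)
      \<comment> \<open>The edge leading outwards from the private boundary vertex of \<open>v\<close> is uncovered.\<close>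
      let ?e = "(fst u, 2 :: nat)"
      have tc: "towards_centre ?e = u" using u1 by (simp add: towards_centre_def prod_eq_iff)
      \<comment> \<open>The outer end is at distance \<open>r + 2\<close> from \<open>v\<close>,
        beyond its value \<open>r + 1\<close>; no other broadcast reaches the inner end
        \<open>u\<close>.\<close>
      have "?e \<notin> covered_edges r k f w" if "w \<in> broadcasting (spider r k) f" for w
      proof (cases "w = v")
        case True
        then show ?thesis using u1 ip t pr by (simp add: covered_edges_def spider_dist_def)
      next
        case False
        then show ?thesis
          using u(3)[of w] that by (simp add: covered_edges_def tc broadcasting_def)
      qed
      then have "?U \<subseteq> ?E - {?e}" using U by blast
      moreover have "?e \<in> ?E" using u1 r by simp
      ultimately have "card ?U \<le> k * r - 1"
        using card_mono[of "?E - {?e}" ?U] by (simp add: card_cartesian_product)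
      moreover have "0 < k * r" using k r by simp
      ultimately show ?thesis using W k by simp
    qed
  qed
qed

lemma weight_bnr_independent_le:
  assumes r: "r \<ge> 2" and k: "k \<ge> 3" and b: "broadcast (spider r k) f"
    and bn: "bn_independent (spider r k) f" and ir: "irredundant (spider r k) f"
  shows "weight (spider r k) f \<le> k * (r - 1) + 1"
proof (cases "\<exists>v \<in> broadcasting (spider r k) f. snd v < f v")
  case True
  then have "weight (spider r k) f + (k - 1) \<le> k * r"
    using weight_bnr_independent_le_of_crossing[OF assms] by blast
  then show ?thesis using k by (simp add: diff_mult_distrib2)
next
  case False
  have low: "f v \<le> snd v" if "v \<in> pverts (spider r k)" for v
  proof (rule ccontr)
    assume "\<not> ?thesis"
    then have "v \<in> broadcasting (spider r k) f" "snd v < f v"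
      using that by (auto simp: broadcasting_def)
    then show False using False by blast
  qed
  have h: "h_independent (spider r k) f" by (rule bn_independent_imp_h_independent[OF bn])
  define s where "s i = (\<Sum>p = 1..r. f (i, p))" for i
  have f0: "f (0, 0) = 0" using low[of "(0, 0)"] by (simp add: pverts_spider)
  have sub: "{int p - int (f (i, p))<..int p} \<subseteq> {0<..int r}"
    if "i \<in> {1..k}" "p \<in> {1..r}" for i p
    using low[of "(i, p)"] that by (auto simp: pverts_spider)
  have s_le: "s i \<le> r" if i: "i \<in> {1..k}" for i
    using h_independent_leg_sum_le[OF h i, of "{0<..int r}"] sub[OF i] by (simp add: s_def)
  have s_less: "s i \<le> r - 1" if i: "i \<in> {1..k}" and "f (i, r) \<noteq> r" for i
  proof -
    have fr: "f (i, r) < r" using low[of "(i, r)"] that r by (auto simp: pverts_spider)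
    \<comment> \<open>\<open>z\<close> is a point missed by all intervals. If the leaf broadcasts,
      \<open>z\<close> lies just below its interval, and strictness in h-independence keeps every
      other position below \<open>z\<close>; if it is silent, \<open>z\<close> is the leaf itself.
      Since \<open>f (i, r) < r\<close>, \<open>z\<close> is positive and costs one unit.\<close>
    define z where "z = int r - int (f (i, r))"
    have "z \<notin> {int p - int (f (i, p))<..int p}" if "p \<in> {1..r}" "0 < f (i, p)" for p
      using h_independent_spiderD[OF h, of "(i, p)" "(i, r)"] that i r
      by (cases "p = r"; cases "f (i, r) = 0")
        (auto simp: z_def pverts_spider spider_dist_def)
    then have "s i \<le> card ({0<..int r} - {z})"
      unfolding s_def using sub[OF i] by (intro h_independent_leg_sum_le[OF h i]) blast+
    then show ?thesis using fr by (simp add: z_def)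
  qed
  have uniq: "i = i'"
    if "i \<in> {1..k}" "i' \<in> {1..k}" "f (i, r) = r" "f (i', r) = r" for i i'
  proof (rule ccontr)
    assume "i \<noteq> i'"
    have "(i, r) \<in> pverts (spider r k)" "2 \<le> f (i, r)" using that r by (auto simp: pverts_spider)
    from ex_private_boundary_spider[OF ir this] obtain u
      where u: "u \<in> pverts (spider r k)" "spider_dist u (i, r) = f (i, r)"
        "\<And>w. w \<in> pverts (spider r k) \<Longrightarrow> w \<noteq> (i, r) \<Longrightarrow> 0 < f w \<Longrightarrow> f w < spider_dist u w"
      by metis
    \<comment> \<open>The distance from a leaf is below \<open>r\<close> on its own leg and above
      \<open>r\<close> on the other legs, so only the centre is at distance \<open>r\<close>. But
      the centre hears the second leaf.\<close>
    then have "u = (0, 0)"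
      using that r by (auto simp: pverts_spider spider_dist_def split: if_splits)
    then show False
      using u(3)[of "(i', r)"] that r \<open>i \<noteq> i'\<close> by (auto simp: pverts_spider spider_dist_def)
  qed
  have W: "weight (spider r k) f = sum s {1..k}" using f0 by (simp add: weight_spider s_def)
  show ?thesis
  proof (cases "\<exists>i \<in> {1..k}. f (i, r) = r")
    case True
    then obtain i where i: "i \<in> {1..k}" "f (i, r) = r" by blast
    have "s i' \<le> r - 1" if "i' \<in> {1..k} - {i}" for i'
      using s_less[of i'] uniq[OF i(1) _ i(2), of i'] that by blast
    then have "sum s ({1..k} - {i}) \<le> of_nat (card ({1..k} - {i})) * (r - 1)"
      by (rule sum_bounded_above)
    moreover have "card ({1..k} - {i}) = k - 1" using i by simp
    moreover have "sum s {1..k} = s i + sum s ({1..k} - {i})" using i by (simp add: sum.remove)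
    ultimately have "sum s {1..k} \<le> r + (k - 1) * (r - 1)" using s_le[OF i(1)] by simp
    also have "\<dots> = k * (r - 1) + 1" using k r by (cases k) simp_all
    finally show ?thesis using W by simp
  next
    case False
    then have "sum s {1..k} \<le> of_nat (card {1..k}) * (r - 1)"
      by (intro sum_bounded_above s_less) auto
    then show ?thesis using W by simp
  qed
qed

lemma alpha_bnr_spider:
  assumes r: "r \<ge> 2" and k: "k \<ge> 3"
  shows "alpha_bnr (spider r k) = k * (r - 1) + 1"
proof -
  let ?g = "\<lambda>v :: nat \<times> nat. if snd v = r then if fst v = 1 then r else r - 1 else 0"
  let ?P = "\<lambda>f. broadcast (spider r k) f \<and> bnr_independent (spider r k) f"
  have b: "broadcast (spider r k) ?g" using r k by (auto simp: broadcast_spider_iff)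
  have bn: "bn_independent (spider r k) ?g"
    by (rule bn_independent_of_leaves) (simp split: if_splits)
  have ir: "irredundant (spider r k) ?g"
    unfolding irredundant_def
  proof
    fix v assume v: "v \<in> broadcasting (spider r k) ?g"
    then obtain i where i: "v = (i, r)" "i \<in> {1..k}"
      using r by (auto simp: broadcasting_def pverts_spider split: if_splits)
    \<comment> \<open>The leaf of value \<open>r\<close> has the centre as private boundary vertex,
      since the values \<open>r - 1\<close> fall short of it. For the other leaves it is the first
      vertex of their own leg, at distance \<open>r + 1\<close> from every other leaf.\<close>
    define u where "u = (if i = 1 then (0, 0) else (i, 1 :: nat))"
    have u: "u \<in> pverts (spider r k)" using r i by (simp add: u_def pverts_spider)
    have "spider_dist u v \<le> ?g v" using r i by (simp add: u_def spider_dist_def)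
    moreover have "(?g(v := ?g v - 1)) w < spider_dist u w" if "0 < (?g(v := ?g v - 1)) w" for w
    proof (cases "w = v")
      case True
      then show ?thesis using that r i by (simp add: u_def spider_dist_def split: if_splits)
    next
      case False
      then have "snd w = r" "fst w \<noteq> i" using that i by (auto simp: prod_eq_iff split: if_splits)
      then show ?thesis using False r by (auto simp: u_def spider_dist_def)
    qed
    then have "\<not> hears (spider r k) (?g(v := ?g v - 1)) u w" for w
      unfolding hears_spider_iff by (meson not_le)
    moreover have "gdist (spider r k) u v = spider_dist u v"
      using u v by (simp add: gdist_spider broadcasting_def)
    ultimately have "u \<in> private_boundary (spider r k) ?g v"
      using u unfolding private_boundary_def nbhd_def by simp
    then show "private_boundary (spider r k) ?g v \<noteq> {}" by blast
  qed
  have w: "weight (spider r k) ?g = k * (r - 1) + 1"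
  proof -
    have "(\<Sum>j = 1..r. ?g (i, j)) = (if i = 1 then r else r - 1)" for i
      using r by simp
    then have "weight (spider r k) ?g = (\<Sum>i = 1..k. if i = 1 then r else r - 1)"
      using r by (simp add: weight_spider)
    also have "\<dots> = r + (\<Sum>i \<in> {1..k} - {1}. if i = 1 then r else r - 1)"
      using k by (subst sum.remove[of _ 1]) auto
    also have "(\<Sum>i \<in> {1..k} - {1}. if i = 1 then r else r - 1) = (\<Sum>i \<in> {1..k} - {1}. r - 1)"
      by (rule sum.cong) auto
    also have "r + \<dots> = r + (k - 1) * (r - 1)" using k by simp
    also have "\<dots> = k * (r - 1) + 1" using k r by (cases k) simp_all
    finally show ?thesis .
  qed
  have "Max {weight (spider r k) f | f. ?P f} = k * (r - 1) + 1"
    using weight_bnr_independent_le[OF r k] b bn ir w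
    by (intro Max_weight_eqI[where g = ?g]) (auto simp: bnr_independent_def)
  then show ?thesis by (simp add: alpha_bnr_def)
qed

theorem mainTheorem6:
  shows "(\<forall>r k :: nat. r \<ge> 2 \<and> k \<ge> 3 \<longrightarrow>
            int (alpha_h (spider r k)) - int (alpha_bn (spider r k)) = int k * (int r - 1) \<and>
            int (alpha_h (spider r k)) - int (alpha_bnr (spider r k)) = int k * int r - 1 \<and>
            int (alpha_bn (spider r k)) - int (alpha_bnr (spider r k)) = int k - 1) \<and>
         (\<forall>M :: nat. \<exists>G :: (nat \<times> nat) pair_pre_digraph. nontrivial_connected_graph G \<and>
            int (alpha_h G) - int (alpha_bn G) \<ge> int M) \<and>
         (\<forall>M :: nat. \<exists>G :: (nat \<times> nat) pair_pre_digraph. nontrivial_connected_graph G \<and>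
            int (alpha_h G) - int (alpha_bnr G) \<ge> int M) \<and>
         (\<forall>M :: nat. \<exists>G :: (nat \<times> nat) pair_pre_digraph. nontrivial_connected_graph G \<and>
            int (alpha_bn G) - int (alpha_bnr G) \<ge> int M)"
proof -
  have diffs: "int (alpha_h (spider r k)) - int (alpha_bn (spider r k)) = int k * (int r - 1)"
    "int (alpha_h (spider r k)) - int (alpha_bnr (spider r k)) = int k * int r - 1"
    "int (alpha_bn (spider r k)) - int (alpha_bnr (spider r k)) = int k - 1"
    if "r \<ge> 2" "k \<ge> 3" for r k
    using that
    by (simp_all add: alpha_h_spider alpha_bn_spider alpha_bnr_spider of_nat_diff algebra_simps)
  \<comment> \<open>With \<open>r = 2\<close> and \<open>k = M + 3\<close> the differences are
    \<open>M + 3\<close>, \<open>2 * M + 5\<close> and \<open>M + 2\<close>, so one family serves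
    all three claims.\<close>
  have conn: "nontrivial_connected_graph (spider 2 (M + 3))" for M
    by (rule nontrivial_connected_spider) auto
  have "\<exists>G :: (nat \<times> nat) pair_pre_digraph. nontrivial_connected_graph G \<and>
      int (alpha_h G) - int (alpha_bn G) \<ge> int M" for M
    using conn[of M] diffs(1)[of 2 "M + 3"] by (intro exI[of _ "spider 2 (M + 3)"]) simp
  moreover have "\<exists>G :: (nat \<times> nat) pair_pre_digraph. nontrivial_connected_graph G \<and>
      int (alpha_h G) - int (alpha_bnr G) \<ge> int M" for M
    using conn[of M] diffs(2)[of 2 "M + 3"] by (intro exI[of _ "spider 2 (M + 3)"]) simp
  moreover have "\<exists>G :: (nat \<times> nat) pair_pre_digraph. nontrivial_connected_graph G \<and>
      int (alpha_bn G) - int (alpha_bnr G) \<ge> int M" for M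
    using conn[of M] diffs(3)[of 2 "M + 3"] by (intro exI[of _ "spider 2 (M + 3)"]) simp
  ultimately show ?thesis using diffs by blast
qed

end
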